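(* (1) Let $T_0$ be a complete theory in a language consisting of unary predicate symbols $P_i$, $i\in I$, and having infinite models. Then $T_0$ is exactly $(|T_0|,\mathcal{T}_0)$-approximable, where $\mathcal{T}_0$ is the class of all complete theories in finite languages of unary predicate symbols that have finite models. (2) Every complete theory $T_0$ in a language of unary predicate symbols $P_i$, $i\in I$, having infinite models, is countably approximable by some appropriate class $\mathcal{T}_0$ of theories in languages of unary predicates. (3) Let $T_1$ be a complete theory in a language of unary predicate symbols which has finite models. Then $T_1$ is approximable if and only if its language is infinite, and $T_1$ is countably approximable (by some appropriate class of theories) if and only if its language is infinite.
   Context: All theories are complete first-order theories in relational languages; $|T|$ denotes the cardinality of the set of sentences of $T$ (so $|T_0|=|I|+\omega$ here). For a class $\mathcal{T}$ and a theory $T\notin\mathcal{T}$, $T$ is $\mathcal{T}$-approximable if for every sentence $\varphi\in T$ there is $T'\in\mathcal{T}$ with $\varphi\in T'$ (in particular $\varphi$ is a sentence of the language of $T'$); $T$ is approximable if it is $\mathcal{T}$-approximable for some $\mathcal{T}$. For a cardinal $\lambda$, $T$ is $(\lambda,\mathcal{T})$-approximable if $T$ is $\mathcal{T}'$-approximable for some $\mathcal{T}'\subseteq\mathcal{T}$ with $|\mathcal{T}'|=\lambda$; it is exactly $(\lambda,\mathcal{T})$-approximable if moreover it is not $(\mu,\mathcal{T})$-approximable for any $\mu<\lambda$. $T$ is countably approximable (by $\mathcal{T}$) if it is $(\omega,\mathcal{T})$-approximable.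
   Formalization: In (3), "approximable" and "countably approximable" only allow classes of complete theories none of which properly contains T_1; otherwise expansions of T_1 to larger languages approximate every T_1 with a finite language and the claim is false. The same restriction is added to the class in (2). *)

theory Defs
  imports Main
begin

unbundle cardinal_syntax

text \<open>
  First-order logic with equality over relational languages.  A relation symbol is a name together
  with an arity, and a language is a set of such pairs.  The atom \<open>Rel p xs\<close> uses the symbol
  \<open>(p, length xs)\<close>, so every value of type \<open>'p form\<close> is a well-formed formula.  Variables are named
  by natural numbers.
\<close>

datatype 'p form =
    Eq nat nat
  | Rel 'p "nat list"
  | Neg "'p form"
  | Conj "'p form" "'p form"
  | Exists nat "'p form"

primrec free_vars :: "'p form \<Rightarrow> nat set" where
  "free_vars (Eq x y) = {x, y}"
| "free_vars (Rel p xs) = set xs"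
| "free_vars (Neg \<phi>) = free_vars \<phi>"
| "free_vars (Conj \<phi> \<psi>) = free_vars \<phi> \<union> free_vars \<psi>"
| "free_vars (Exists x \<phi>) = free_vars \<phi> - {x}"

primrec symbols :: "'p form \<Rightarrow> ('p \<times> nat) set" where
  "symbols (Eq x y) = {}"
| "symbols (Rel p xs) = {(p, length xs)}"
| "symbols (Neg \<phi>) = symbols \<phi>"
| "symbols (Conj \<phi> \<psi>) = symbols \<phi> \<union> symbols \<psi>"
| "symbols (Exists x \<phi>) = symbols \<phi>"

definition sentences :: "('p \<times> nat) set \<Rightarrow> 'p form set" where
  "sentences L = {\<phi>. free_vars \<phi> = {} \<and> symbols \<phi> \<subseteq> L}"

text \<open>
  A structure interprets every symbol that can be formed from the type \<open>'p\<close>; sentences of a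
  language \<open>L\<close> only see its reduct to \<open>L\<close>.
\<close>

datatype ('p, 'a) struct = Struct (univ: "'a set") (interp: "'p \<Rightarrow> 'a list \<Rightarrow> bool")

primrec sat :: "('p, 'a) struct \<Rightarrow> (nat \<Rightarrow> 'a) \<Rightarrow> 'p form \<Rightarrow> bool" where
  "sat M e (Eq x y) \<longleftrightarrow> e x = e y"
| "sat M e (Rel p xs) \<longleftrightarrow> interp M p (map e xs)"
| "sat M e (Neg \<phi>) \<longleftrightarrow> \<not> sat M e \<phi>"
| "sat M e (Conj \<phi> \<psi>) \<longleftrightarrow> sat M e \<phi> \<and> sat M e \<psi>"
| "sat M e (Exists x \<phi>) \<longleftrightarrow> (\<exists>a \<in> univ M. sat M (e(x := a)) \<phi>)"

definition holds_in :: "('p, 'a) struct \<Rightarrow> 'p form \<Rightarrow> bool" where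
  "holds_in M \<phi> \<longleftrightarrow> (\<forall>e. range e \<subseteq> univ M \<longrightarrow> sat M e \<phi>)"

definition is_model :: "('p, 'a) struct \<Rightarrow> 'p form set \<Rightarrow> bool" where
  "is_model M T \<longleftrightarrow> univ M \<noteq> {} \<and> (\<forall>\<phi> \<in> T. holds_in M \<phi>)"

text \<open>
  HOL cannot quantify over the universes of all types at once.  Models are therefore taken with
  universe a set of elements of \<open>'p + nat\<close>, whose cardinality is \<open>max |'p| \<omega>\<close>.  By the
  Loewenheim-Skolem theorem this loses nothing: a theory in a language with symbols named in \<open>'p\<close>
  has a model (a finite model, an infinite model) iff it has one of this kind.
\<close>

type_synonym 'p model = "('p, 'p + nat) struct"

definition has_finite_model :: "'p form set \<Rightarrow> bool" where
  "has_finite_model T \<longleftrightarrow> (\<exists>M :: 'p model. is_model M T \<and> finite (univ M))"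

definition has_infinite_model :: "'p form set \<Rightarrow> bool" where
  "has_infinite_model T \<longleftrightarrow> (\<exists>M :: 'p model. is_model M T \<and> infinite (univ M))"

text \<open>
  Complete theories are maximal satisfiable sets of \<open>L\<close>-sentences; they are automatically closed
  under consequence.
\<close>

definition complete_theory :: "('p \<times> nat) set \<Rightarrow> 'p form set \<Rightarrow> bool" where
  "complete_theory L T \<longleftrightarrow>
     T \<subseteq> sentences L \<and> (\<exists>M :: 'p model. is_model M T) \<and>
     (\<forall>\<phi> \<in> sentences L. \<phi> \<in> T \<or> Neg \<phi> \<in> T)"

definition unary :: "'p set \<Rightarrow> ('p \<times> nat) set" where
  "unary I = I \<times> {1}"

definition approximable_by :: "'p form set set \<Rightarrow> 'p form set \<Rightarrow> bool" where
  "approximable_by \<T> T \<longleftrightarrow> T \<notin> \<T> \<and> (\<forall>\<phi> \<in> T. \<exists>T' \<in> \<T>. \<phi> \<in> T')"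

text \<open>Cardinals are represented, as in the library, by cardinal orders.\<close>

definition card_approximable :: "'b rel \<Rightarrow> 'p form set set \<Rightarrow> 'p form set \<Rightarrow> bool" where
  "card_approximable \<kappa> \<T> T \<longleftrightarrow> (\<exists>\<T>' \<subseteq> \<T>. |\<T>'| =o \<kappa> \<and> approximable_by \<T>' T)"

text \<open>
  Every cardinal below \<open>\<kappa>\<close> is order-isomorphic to a cardinal order on the type of \<open>\<kappa>\<close>, so it is
  enough to let \<open>\<mu>\<close> range over that type.
\<close>

definition exactly_card_approximable :: "'b rel \<Rightarrow> 'p form set set \<Rightarrow> 'p form set \<Rightarrow> bool" where
  "exactly_card_approximable \<kappa> \<T> T \<longleftrightarrow>
     card_approximable \<kappa> \<T> T \<and>
     (\<forall>\<mu> :: 'b rel. Card_order \<mu> \<and> \<mu> <o \<kappa> \<longrightarrow> \<not> card_approximable \<mu> \<T> T)"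

definition countably_approximable_by :: "'p form set set \<Rightarrow> 'p form set \<Rightarrow> bool" where
  "countably_approximable_by \<T> T \<longleftrightarrow> card_approximable natLeq \<T> T"

text \<open>
  The classes considered when \<open>T\<close> is said to be approximable by some class of complete theories.
  The condition \<open>\<not> T \<subset> T'\<close> excludes proper expansions of \<open>T\<close> to larger languages: together with
  \<open>T \<notin> \<T>\<close> it says that no member of \<open>\<T>\<close> contains the whole of \<open>T\<close>.  Without it every theory \<open>T\<close>
  whose language omits some symbol would be trivially approximable by a single expansion of \<open>T\<close>.
  Members of the class may be in smaller languages than \<open>T\<close>, or in other languages.
\<close>

definition approximating_class :: "'p form set set \<Rightarrow> 'p form set \<Rightarrow> bool" where
  "approximating_class \<T> T \<longleftrightarrow> (\<forall>T' \<in> \<T>. (\<exists>L. complete_theory L T') \<and> \<not> T \<subset> T')"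

definition approximable :: "'p form set \<Rightarrow> bool" where
  "approximable T \<longleftrightarrow> (\<exists>\<T>. approximating_class \<T> T \<and> approximable_by \<T> T)"

definition countably_approximable :: "'p form set \<Rightarrow> bool" where
  "countably_approximable T \<longleftrightarrow>
     (\<exists>\<T>. approximating_class \<T> T \<and> countably_approximable_by \<T> T)"

definition finite_unary_theories :: "'p form set set" where
  "finite_unary_theories =
     {T. (\<exists>J. finite J \<and> complete_theory (unary J) T) \<and> has_finite_model T}"

end

theory Submission
  imports Defs "HOL-Library.Countable_Set"
begin

text \<open>
  A unary structure is determined, as far as formulas of size at most \<open>k\<close> are concerned, by the
  cardinalities up to \<open>k\<close> of its colour classes, an Ehrenfeucht-Fraisse argument.  Shrinking
  each class to at most \<open>k\<close> elements gives the finite model property, hence one approximating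
  theory per sentence.  No smaller family suffices: a finite one bounds the sizes of finite models,
  and an infinite one covers at most as many sentences as it has members, since each member is
  countable.  In an infinite language, the reducts omitting one of countably many symbols already
  approximate.  In a finite language, a finite model is described up to isomorphism by a single
  sentence mentioning all symbols.
\<close>

section \<open>Cardinalities of colour classes\<close>

text \<open>Thresholds treat finite and infinite sets alike, whereas \<open>card\<close> is 0 on
  every infinite set.\<close>

definition at_least :: "nat \<Rightarrow> 'a set \<Rightarrow> bool" where
  "at_least n X \<longleftrightarrow> (\<exists>A \<subseteq> X. finite A \<and> card A = n)"

lemma at_least_0 [simp]: "at_least 0 X"
  unfolding at_least_def by (intro exI[of _ "{}"]) simp

text \<open>Removing one element per step matches the single quantifier that \<open>counting\<close>
  spends on each element.\<close>

lemma at_least_Suc: "at_least (Suc n) X \<longleftrightarrow> (\<exists>a \<in> X. at_least n (X - {a}))"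
proof
  assume "at_least (Suc n) X"
  then obtain A where A: "A \<subseteq> X" "finite A" "card A = Suc n"
    unfolding at_least_def by blast
  then obtain a where "a \<in> A" by fastforce
  with A have "A - {a} \<subseteq> X - {a}" "finite (A - {a})" "card (A - {a}) = n" "a \<in> X"
    by auto
  then show "\<exists>a \<in> X. at_least n (X - {a})"
    unfolding at_least_def by blast
next
  assume "\<exists>a \<in> X. at_least n (X - {a})"
  then obtain a A where A: "a \<in> X" "A \<subseteq> X - {a}" "finite A" "card A = n"
    unfolding at_least_def by blast
  then have "insert a A \<subseteq> X" "finite (insert a A)" "card (insert a A) = Suc n"
    by (auto simp: card_insert_if)
  then show "at_least (Suc n) X"
    unfolding at_least_def by blast
qed

lemma at_least_antimono: "at_least n X \<Longrightarrow> m \<le> n \<Longrightarrow> at_least m X"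
  unfolding at_least_def by (metis obtain_subset_with_card_n order_trans)

lemma at_least_subset: "at_least n X \<Longrightarrow> X \<subseteq> Y \<Longrightarrow> at_least n Y"
  unfolding at_least_def by blast

lemma at_least_finite: "finite X \<Longrightarrow> at_least n X \<longleftrightarrow> n \<le> card X"
  unfolding at_least_def by (metis card_mono obtain_subset_with_card_n)

lemma at_least_infinite: "infinite X \<Longrightarrow> at_least n X"
  unfolding at_least_def by (metis infinite_arbitrarily_large)

text \<open>A finite set serves as its own witness; in an infinite set any \<open>k\<close> elements
  pass all thresholds up to \<open>k\<close>.\<close>

lemma finite_subset_same_at_least:
  "\<exists>A \<subseteq> X. finite A \<and> (\<forall>m \<le> k. at_least m A \<longleftrightarrow> at_least m X)"
proof (cases "finite X")
  case False
  then obtain A where "finite A" "card A = k" "A \<subseteq> X"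
    using infinite_arbitrarily_large by blast
  with False show ?thesis
    by (auto simp: at_least_finite at_least_infinite)
qed auto

text \<open>This is the quantifier-free type of one element. As all predicates are unary, colours
  and equalities determine every atomic formula about a tuple.\<close>

definition color :: "'p set \<Rightarrow> ('p, 'a) struct \<Rightarrow> 'a \<Rightarrow> 'p set" where
  "color J M a = {p \<in> J. interp M p [a]}"

definition color_class :: "'p set \<Rightarrow> ('p, 'a) struct \<Rightarrow> 'p set \<Rightarrow> 'a set" where
  "color_class J M S = {a \<in> univ M. color J M a = S}"

text \<open>Letting \<open>S\<close> range over all sets is harmless: the class is empty unless
  \<open>S\<close> is a subset of \<open>J\<close>.\<close>

definition similar :: "nat \<Rightarrow> 'p set \<Rightarrow> ('p, 'a) struct \<Rightarrow> ('p, 'b) struct \<Rightarrow> bool" where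
  "similar k J M N \<longleftrightarrow>
     (\<forall>m \<le> k. \<forall>S. at_least m (color_class J M S) \<longleftrightarrow> at_least m (color_class J N S))"

lemma similar_refl: "similar k J M M"
  by (simp add: similar_def)

lemma similar_sym: "similar k J M N \<Longrightarrow> similar k J N M"
  by (simp add: similar_def)

section \<open>Back and forth\<close>

definition partial_iso :: "'p set \<Rightarrow> nat set \<Rightarrow> ('p, 'a) struct \<Rightarrow> (nat \<Rightarrow> 'a) \<Rightarrow>
    ('p, 'b) struct \<Rightarrow> (nat \<Rightarrow> 'b) \<Rightarrow> bool" where
  "partial_iso J D M e N e' \<longleftrightarrow>
     (\<forall>x \<in> D. e x \<in> univ M \<and> e' x \<in> univ N \<and> color J M (e x) = color J N (e' x)) \<and>
     (\<forall>x \<in> D. \<forall>y \<in> D. e x = e y \<longleftrightarrow> e' x = e' y)"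

lemma partial_iso_sym: "partial_iso J D M e N e' \<Longrightarrow> partial_iso J D N e' M e"
  by (simp add: partial_iso_def)

text \<open>One round of the Ehrenfeucht-Fraisse game. A repeated element gets the old answer. A new
  one shows that its class exceeds the values already used in it, and similarity leaves a spare
  element in the matching class of \<open>N\<close>.\<close>

lemma partial_iso_extend:
  assumes "similar k J M N" and "finite D" and "card D < k"
    and iso: "partial_iso J D M e N e'" and a: "a \<in> univ M"
  shows "\<exists>b \<in> univ N. partial_iso J (insert x D) M (e(x := a)) N (e'(x := b))"
\<comment> \<open>The old value of \<open>x\<close> is about to be overwritten, so it does not count
  as used.\<close>
proof (cases "a \<in> e ` (D - {x})")
  case True
  then obtain y where "y \<in> D - {x}" "a = e y" by blast
  with iso show ?thesis
    by (intro bexI[of _ "e' y"]) (auto simp: partial_iso_def)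
next
  case False
  define S where "S = color J M a"
  define E where "E = {y \<in> D - {x}. color J M (e y) = S}"
  have E: "E = {y \<in> D - {x}. color J N (e' y) = S}"
    using iso by (auto simp: E_def partial_iso_def)
  have "finite E" using \<open>finite D\<close> by (simp add: E_def)
  have "E \<subseteq> D" by (auto simp: E_def)
  have "e' ` E \<subseteq> (\<lambda>u. e' (inv_into E e u)) ` e ` E"
  proof
    fix v assume "v \<in> e' ` E"
    then obtain y where y: "y \<in> E" "v = e' y" by blast
    then have "inv_into E e (e y) \<in> E" "e (inv_into E e (e y)) = e y"
      by (auto intro: inv_into_into f_inv_into_f)
    with y iso \<open>E \<subseteq> D\<close> have "e' (inv_into E e (e y)) = v"
      unfolding partial_iso_def by blast
    with y show "v \<in> (\<lambda>u. e' (inv_into E e u)) ` e ` E"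
      by (intro image_eqI[of _ _ "e y"]) auto
  qed
  then have le: "card (e' ` E) \<le> card (e ` E)"
    using \<open>finite E\<close> by (meson surj_card_le finite_imageI)
  have "insert a (e ` E) \<subseteq> color_class J M S"
    using iso a \<open>E \<subseteq> D\<close> by (auto simp: color_class_def S_def E_def partial_iso_def)
  moreover have "a \<notin> e ` E" using False by (auto simp: E_def)
  ultimately have "at_least (Suc (card (e ` E))) (color_class J M S)"
    unfolding at_least_def using \<open>finite E\<close> by (intro exI[of _ "insert a (e ` E)"]) auto
  moreover have "Suc (card (e ` E)) \<le> k"
    using card_image_le[OF \<open>finite E\<close>, of e] card_mono[OF \<open>finite D\<close> \<open>E \<subseteq> D\<close>] \<open>card D < k\<close>
    by linarith
  ultimately have "at_least (Suc (card (e ` E))) (color_class J N S)"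
    using assms(1) by (auto simp: similar_def)
  then obtain A where A: "A \<subseteq> color_class J N S" "finite A" "card A = Suc (card (e ` E))"
    unfolding at_least_def by blast
  with le have "\<not> A \<subseteq> e' ` E"
    using \<open>finite E\<close> by (metis card_mono finite_imageI not_less_eq_eq)
  then obtain b where b: "b \<in> A" "b \<notin> e' ` E" by blast
  with A have "b \<in> univ N" "color J N b = S" by (auto simp: color_class_def)
  moreover from this b have "b \<notin> e' ` (D - {x})" by (auto simp: E)
  ultimately show ?thesis
    using iso a False S_def
    by (intro bexI[of _ b]) (auto simp: partial_iso_def)
qed

text \<open>The bound \<open>card D + size \<phi> \<le> k\<close> survives the induction: a
  quantifier puts at most one variable into \<open>D\<close> and shortens the formula by at least
  one.\<close>

lemma sat_similar:
  assumes "similar k J M N"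
    and "symbols \<phi> \<subseteq> unary J" and "free_vars \<phi> \<subseteq> D" and "finite D" and "card D + size \<phi> \<le> k"
    and "partial_iso J D M e N e'"
  shows "sat M e \<phi> \<longleftrightarrow> sat N e' \<phi>"
  using assms(2-)
proof (induction \<phi> arbitrary: D e e')
  case (Eq x y)
  then show ?case by (auto simp: partial_iso_def)
next
  case (Rel p xs)
  then have "p \<in> J" "length xs = 1" by (auto simp: unary_def)
  then obtain x where "xs = [x]" by (auto simp: length_Suc_conv)
  with Rel have "color J M (e x) = color J N (e' x)" by (auto simp: partial_iso_def)
  with \<open>p \<in> J\<close> \<open>xs = [x]\<close> show ?case by (auto simp: color_def)
next
  case (Neg \<phi>)
  from Neg.IH[of D e e'] Neg.prems show ?case by auto
next
  case (Conj \<phi> \<psi>)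
  from Conj.IH(1)[of D e e'] Conj.IH(2)[of D e e'] Conj.prems show ?case by auto
next
  case (Exists x \<phi>)
  have "card (insert x D) \<le> Suc (card D)" by (rule card_insert_le_m1) auto
  with Exists.prems have IH: "sat M e \<phi> \<longleftrightarrow> sat N e' \<phi>"
    if "partial_iso J (insert x D) M e N e'" for e e'
    by (intro Exists.IH[OF _ _ _ _ that]) auto
  have "card D < k" using Exists.prems by simp
  note step = partial_iso_extend[OF assms(1) \<open>finite D\<close> this Exists.prems(5), of _ x]
    partial_iso_extend[OF similar_sym[OF assms(1)] \<open>finite D\<close> this
      partial_iso_sym[OF Exists.prems(5)], of _ x]
  show ?case
  proof
    assume "sat M e (Exists x \<phi>)"
    then obtain a where "a \<in> univ M" "sat M (e(x := a)) \<phi>" by auto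
    with step(1) IH show "sat N e' (Exists x \<phi>)" by fastforce
  next
    assume "sat N e' (Exists x \<phi>)"
    then obtain b where "b \<in> univ N" "sat N (e'(x := b)) \<phi>" by auto
    with step(2) IH[OF partial_iso_sym] show "sat M e (Exists x \<phi>)" by fastforce
  qed
qed

text \<open>With \<open>D\<close> empty nothing is asked of the assignments, which may even leave
  the universes; this justifies the later use of \<open>undefined\<close>.\<close>

lemma sat_sentence_similar:
  assumes "\<phi> \<in> sentences (unary J)" and "similar (size \<phi>) J M N"
  shows "sat M e \<phi> \<longleftrightarrow> sat N e' \<phi>"
  using assms by (intro sat_similar[of "size \<phi>" J M N \<phi> "{}"]) (auto simp: sentences_def partial_iso_def)

section \<open>Complete theories\<close>

lemma sentences_mono: "L \<subseteq> L' \<Longrightarrow> sentences L \<subseteq> sentences L'"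
  by (auto simp: sentences_def)

lemma finite_symbols: "finite (symbols \<phi>)"
  by (induction \<phi>) auto

lemma set_form_symbols: "set_form \<phi> = fst ` symbols \<phi>"
  by (induction \<phi>) auto

text \<open>Comparing \<open>M\<close> with itself shows that the assignment is irrelevant. In an
  empty universe \<open>holds_in\<close> would be vacuous.\<close>

lemma holds_in_iff_sat:
  assumes "\<phi> \<in> sentences (unary J)" and "univ M \<noteq> {}"
  shows "holds_in M \<phi> \<longleftrightarrow> sat M e \<phi>"
proof -
  have eq: "sat M e' \<phi> \<longleftrightarrow> sat M e \<phi>" for e'
    by (rule sat_sentence_similar[OF assms(1) similar_refl])
  obtain a where "a \<in> univ M" using assms(2) by blast
  then have "range (\<lambda>_ :: nat. a) \<subseteq> univ M" by auto
  with eq show ?thesis unfolding holds_in_def by metis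
qed

lemma holds_in_similar:
  assumes "\<phi> \<in> sentences (unary J)" and "similar (size \<phi>) J M N"
    and "univ M \<noteq> {}" and "univ N \<noteq> {}"
  shows "holds_in M \<phi> \<longleftrightarrow> holds_in N \<phi>"
  unfolding holds_in_iff_sat[OF assms(1,3), of "\<lambda>_. undefined"]
    holds_in_iff_sat[OF assms(1,4), of "\<lambda>_. undefined"]
  by (rule sat_sentence_similar[OF assms(1,2)])

lemma holds_in_Neg:
  assumes "\<phi> \<in> sentences (unary J)" and "univ M \<noteq> {}"
  shows "holds_in M (Neg \<phi>) \<longleftrightarrow> \<not> holds_in M \<phi>"
proof -
  have "Neg \<phi> \<in> sentences (unary J)" using assms(1) by (auto simp: sentences_def)
  then show ?thesis
    using holds_in_iff_sat[OF _ assms(2)] assms(1) sat.simps(3) by metis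
qed

text \<open>A constant assignment refutes \<open>Neg \<phi>\<close> once \<open>\<phi>\<close>
  holds, so completeness leaves only \<open>\<phi>\<close>. The language is arbitrary here, since
  approximating theories may use non-unary symbols.\<close>

lemma complete_theory_mem_iff:
  assumes "complete_theory L T" and "is_model M T" and "\<phi> \<in> sentences L"
  shows "\<phi> \<in> T \<longleftrightarrow> holds_in M \<phi>"
proof
  assume "holds_in M \<phi>"
  moreover obtain a where "range (\<lambda>_::nat. a) \<subseteq> univ M"
    using assms(2) by (auto simp: is_model_def)
  ultimately have "\<not> holds_in M (Neg \<phi>)" by (auto simp: holds_in_def)
  with assms show "\<phi> \<in> T" by (auto simp: is_model_def complete_theory_def)
qed (use assms in \<open>auto simp: is_model_def\<close>)

lemma complete_theory_of_model:
  fixes M :: "'p model"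
  assumes "univ M \<noteq> {}"
  shows "complete_theory (unary J) {\<phi> \<in> sentences (unary J). holds_in M \<phi>}"
  unfolding complete_theory_def
proof (intro conjI ballI)
  show "\<exists>N :: 'p model. is_model N {\<phi> \<in> sentences (unary J). holds_in M \<phi>}"
    using assms by (auto simp: is_model_def)
next
  fix \<phi> assume "\<phi> \<in> sentences (unary J)"
  then show "\<phi> \<in> {\<phi> \<in> sentences (unary J). holds_in M \<phi>} \<or>
             Neg \<phi> \<in> {\<phi> \<in> sentences (unary J). holds_in M \<phi>}"
    using holds_in_Neg[OF _ assms] by (auto simp: sentences_def)
qed auto

lemma complete_theory_reduct:
  assumes "complete_theory L T" and "L' \<subseteq> L"
  shows "complete_theory L' (T \<inter> sentences L')"
  unfolding complete_theory_def
proof (intro conjI ballI)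
  show "\<exists>M :: 'a model. is_model M (T \<inter> sentences L')"
    using assms(1) by (auto simp: complete_theory_def is_model_def)
next
  fix \<phi> assume "\<phi> \<in> sentences L'"
  moreover from this have "\<phi> \<in> sentences L" "Neg \<phi> \<in> sentences L'"
    using sentences_mono[OF assms(2)] by (auto simp: sentences_def)
  ultimately show "\<phi> \<in> T \<inter> sentences L' \<or> Neg \<phi> \<in> T \<inter> sentences L'"
    using assms(1) by (auto simp: complete_theory_def)
qed blast

section \<open>Counting sentences\<close>

text \<open>The empty conjunction says that every element equals itself, a truth with no symbols and
  no free variables.\<close>

primrec conj_list :: "'p form list \<Rightarrow> 'p form" where
  "conj_list [] = Neg (Exists 0 (Neg (Eq 0 0)))"
| "conj_list (\<phi> # \<phi>s) = Conj \<phi> (conj_list \<phi>s)"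

lemma sat_conj_list [simp]: "sat M e (conj_list \<phi>s) \<longleftrightarrow> (\<forall>\<phi> \<in> set \<phi>s. sat M e \<phi>)"
  by (induction \<phi>s) auto

lemma free_vars_conj_list [simp]: "free_vars (conj_list \<phi>s) = (\<Union>\<phi> \<in> set \<phi>s. free_vars \<phi>)"
  by (induction \<phi>s) auto

lemma symbols_conj_list [simp]: "symbols (conj_list \<phi>s) = (\<Union>\<phi> \<in> set \<phi>s. symbols \<phi>)"
  by (induction \<phi>s) auto

text \<open>
  With variables below \<open>m\<close> free, \<open>counting \<theta> k m\<close> asserts that at least \<open>k\<close> elements other than
  the values of these variables satisfy \<open>\<theta>\<close>.
\<close>

primrec counting :: "(nat \<Rightarrow> 'p form) \<Rightarrow> nat \<Rightarrow> nat \<Rightarrow> 'p form" where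
  "counting \<theta> 0 m = conj_list []"
| "counting \<theta> (Suc k) m = Exists m
     (conj_list (\<theta> m # counting \<theta> k (Suc m) # map (\<lambda>i. Neg (Eq i m)) [0..<m]))"

text \<open>The witness chosen for variable \<open>m\<close> joins the excluded values, which is the
  recursion of \<open>at_least_Suc\<close>.\<close>

lemma sat_counting:
  assumes "\<And>e x. sat M e (\<theta> x) \<longleftrightarrow> P (e x)"
  shows "sat M e (counting \<theta> k m) \<longleftrightarrow> at_least k ({a \<in> univ M. P a} - e ` {..<m})"
proof (induction k arbitrary: e m)
  case 0
  show ?case by simp
next
  case (Suc k)
  have upd: "(e(m := a)) ` {..<Suc m} = insert a (e ` {..<m})" for a
    by (auto simp: lessThan_Suc)
  have "sat M e (counting \<theta> (Suc k) m) \<longleftrightarrow>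
        (\<exists>a \<in> univ M. P a \<and> a \<notin> e ` {..<m} \<and>
           at_least k ({a \<in> univ M. P a} - insert a (e ` {..<m})))"
    unfolding counting.simps sat.simps sat_conj_list list.set ball_simps Suc.IH upd assms set_map
    by (intro bex_cong) (auto simp: image_iff)
  also have "\<dots> \<longleftrightarrow> at_least (Suc k) ({a \<in> univ M. P a} - e ` {..<m})"
    unfolding at_least_Suc Diff_insert[of _ _ "e ` {..<m}"] by blast
  finally show ?case .
qed

lemma free_vars_counting:
  "(\<And>x. free_vars (\<theta> x) \<subseteq> {x}) \<Longrightarrow> free_vars (counting \<theta> k m) \<subseteq> {..<m}"
proof (induction k arbitrary: m)
  case (Suc k)
  then have "free_vars (counting \<theta> k (Suc m)) \<subseteq> {..<Suc m}" by blast
  then show ?case using Suc.prems[of m] by (auto simp: less_Suc_eq)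
qed simp

lemma symbols_counting: "symbols (counting \<theta> k m) = (\<Union>x \<in> {m..<m + k}. symbols (\<theta> x))"
proof (induction k arbitrary: m)
  case (Suc k)
  have "{m..<m + Suc k} = insert m {Suc m..<Suc m + k}" by auto
  with Suc show ?case by auto
qed simp

definition size_sentence :: "nat \<Rightarrow> 'p form" where
  "size_sentence n = counting (\<lambda>_. conj_list []) n 0"

lemma size_sentence_in_sentences: "size_sentence n \<in> sentences L"
  using free_vars_counting[of "\<lambda>_. conj_list []" n 0]
  by (auto simp: size_sentence_def sentences_def symbols_counting)

lemma holds_in_size_sentence:
  assumes "univ M \<noteq> {}"
  shows "holds_in M (size_sentence n) \<longleftrightarrow> at_least n (univ M)"
proof -
  have "holds_in M (size_sentence n) \<longleftrightarrow> sat M (\<lambda>_. undefined) (size_sentence n)"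
    by (rule holds_in_iff_sat[OF size_sentence_in_sentences assms])
  also have "\<dots> \<longleftrightarrow> at_least n (univ M)"
    using sat_counting[of M "\<lambda>_. conj_list []" "\<lambda>_. True"] by (simp add: size_sentence_def)
  finally show ?thesis .
qed

definition color_form :: "'p list \<Rightarrow> 'p set \<Rightarrow> nat \<Rightarrow> 'p form" where
  "color_form ps S x = conj_list (map (\<lambda>p. if p \<in> S then Rel p [x] else Neg (Rel p [x])) ps)"

definition color_sentence :: "'p list \<Rightarrow> 'p set \<Rightarrow> nat \<Rightarrow> 'p form" where
  "color_sentence ps S n = counting (color_form ps S) n 0"

text \<open>For \<open>n > 0\<close> every predicate of \<open>ps\<close> occurs, so a theory
  containing the sentence must have all of them in its language.\<close>

lemma symbols_color_sentence:
  "symbols (color_sentence ps S n) = (if n = 0 then {} else unary (set ps))"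
  by (auto simp: color_sentence_def symbols_counting color_form_def unary_def split: if_splits)

lemma color_sentence_in_sentences: "color_sentence ps S n \<in> sentences (unary (set ps))"
proof -
  have "free_vars (color_form ps S x) \<subseteq> {x}" for x
    by (auto simp: color_form_def split: if_splits)
  then have "free_vars (color_sentence ps S n) = {}"
    using free_vars_counting[of "color_form ps S" n 0] by (simp add: color_sentence_def)
  then show ?thesis
    by (simp add: sentences_def symbols_color_sentence)
qed

text \<open>\<open>color_form\<close> sees only the part of \<open>S\<close> inside
  \<open>set ps\<close>, while the colour class of any \<open>S\<close> reaching outside is empty;
  hence the assumption.\<close>

lemma sat_color_sentence:
  assumes "S \<subseteq> set ps"
  shows "sat M e (color_sentence ps S n) \<longleftrightarrow> at_least n (color_class (set ps) M S)"
proof -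
  have "sat M e (color_form ps S x) \<longleftrightarrow> color (set ps) M (e x) = S" for e x
    unfolding color_form_def sat_conj_list set_map ball_simps color_def
    using assms by (auto split: if_splits)
  from sat_counting[OF this] show ?thesis
    by (simp add: color_sentence_def color_class_def)
qed

section \<open>The finite model property\<close>

text \<open>Finitely many predicates give finitely many colours, so shrinking each class separately
  yields a finite substructure.\<close>

lemma exists_finite_similar:
  fixes M :: "('p, 'a) struct"
  assumes "finite J" and "univ M \<noteq> {}" and "k > 0"
  shows "\<exists>N :: ('p, 'a) struct. finite (univ N) \<and> univ N \<noteq> {} \<and> similar k J M N"
proof -
  have "\<forall>S. \<exists>A. A \<subseteq> color_class J M S \<and> finite A \<and>
      (\<forall>m \<le> k. at_least m A \<longleftrightarrow> at_least m (color_class J M S))"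
    by (intro allI finite_subset_same_at_least)
  from choice[OF this] obtain A where "\<forall>S. A S \<subseteq> color_class J M S \<and> finite (A S) \<and>
      (\<forall>m \<le> k. at_least m (A S) \<longleftrightarrow> at_least m (color_class J M S))" ..
  then have A: "\<And>S. A S \<subseteq> color_class J M S" "\<And>S. finite (A S)"
    "\<And>S m. m \<le> k \<Longrightarrow> at_least m (A S) \<longleftrightarrow> at_least m (color_class J M S)"
    by simp_all
  define N where "N = Struct (\<Union>S \<in> Pow J. A S) (interp M)"
  have A_empty: "A S = {}" if "\<not> S \<subseteq> J" for S
    using A(1)[of S] that by (auto simp: color_class_def color_def)
  have "color_class J N S = A S" for S
    using A(1) A_empty[of S] by (fastforce simp: color_class_def color_def N_def)
  then have sim: "similar k J M N" by (simp add: similar_def A(3))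
  obtain a where "a \<in> univ M" using assms(2) by blast
  \<comment> \<open>Threshold 1, available because \<open>k > 0\<close>, keeps an inhabited class
    inhabited.\<close>
  then have "at_least 1 (color_class J M (color J M a))"
    unfolding at_least_def by (intro exI[of _ "{a}"]) (auto simp: color_class_def)
  then have "at_least 1 (color_class J N (color J M a))"
    using sim \<open>k > 0\<close> by (auto simp: similar_def)
  then have "univ N \<noteq> {}"
    by (auto simp: at_least_Suc color_class_def)
  moreover have "finite (univ N)" using assms(1) A(2) by (auto simp: N_def)
  ultimately show ?thesis using sim by blast
qed

text \<open>Only the finitely many symbols of \<open>\<phi>\<close> matter: shrink a model of
  \<open>T\<close> relative to them and take the theory of the result in that language.\<close>

lemma exists_finite_unary_theory:
  assumes "complete_theory (unary I) T" and "\<phi> \<in> T"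
  shows "\<exists>T' \<in> finite_unary_theories. \<phi> \<in> T'"
proof -
  obtain M :: "'a model" where M: "is_model M T"
    using assms(1) by (auto simp: complete_theory_def)
  define J where "J = fst ` symbols \<phi>"
  have "\<phi> \<in> sentences (unary I)" using assms by (auto simp: complete_theory_def)
  then have \<phi>: "\<phi> \<in> sentences (unary J)"
    by (force simp: sentences_def unary_def J_def)
  have "finite J" using finite_symbols by (auto simp: J_def)
  moreover have "univ M \<noteq> {}" using M by (simp add: is_model_def)
  ultimately obtain N :: "'a model"
    \<comment> \<open>The successor only makes the threshold positive, as
      \<open>exists_finite_similar\<close> demands.\<close>
    where N: "finite (univ N)" "univ N \<noteq> {}" "similar (Suc (size \<phi>)) J M N"
    using exists_finite_similar by (metis zero_less_Suc)
  then have "similar (size \<phi>) J M N" by (auto simp: similar_def)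
  then have "holds_in N \<phi>"
    using holds_in_similar[OF \<phi>, of M N] M N \<open>\<phi> \<in> T\<close> by (auto simp: is_model_def)
  moreover have "{\<phi> \<in> sentences (unary J). holds_in N \<phi>} \<in> finite_unary_theories"
    unfolding finite_unary_theories_def has_finite_model_def
    using complete_theory_of_model[OF N(2), of J] \<open>finite J\<close> N
    by (auto simp: is_model_def)
  ultimately show ?thesis
    using \<phi> by (intro bexI[of _ "{\<phi> \<in> sentences (unary J). holds_in N \<phi>}"]) auto
qed

section \<open>Approximation by theories with finite models\<close>

instance form :: (countable) countable
  by countable_datatype

lemma countable_ordLeq_nat: "countable A \<Longrightarrow> |A| \<le>o |UNIV :: nat set|"
  unfolding countable_def card_of_ordLeq[symmetric] by blast

text \<open>An injection of the symbols into the naturals renames formulas injectively, and formulas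
  over \<open>nat\<close> are countable.\<close>

lemma countable_sentences:
  fixes J :: "'p set"
  assumes "countable J"
  shows "countable (sentences (unary J))"
proof -
  have "inj_on (map_form (to_nat_on J)) {\<phi>. set_form \<phi> \<subseteq> J}"
  proof (rule inj_onI)
    fix \<phi> \<psi> :: "'p form"
    assume "\<phi> \<in> {\<phi>. set_form \<phi> \<subseteq> J}" "\<psi> \<in> {\<phi>. set_form \<phi> \<subseteq> J}"
      and "map_form (to_nat_on J) \<phi> = map_form (to_nat_on J) \<psi>"
    then show "\<phi> = \<psi>"
      using inj_on_to_nat_on[OF assms] by (auto intro: form.inj_map_strong dest: inj_onD)
  qed
  then have "countable {\<phi> :: 'p form. set_form \<phi> \<subseteq> J}"
    by (rule countable_image_inj_on[rotated]) (rule countableI_type)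
  then show ?thesis
    by (rule countable_subset[rotated]) (auto simp: sentences_def set_form_symbols unary_def)
qed

lemma size_sentence_in_theory:
  assumes "complete_theory L T" and "has_infinite_model T"
  shows "size_sentence n \<in> T"
proof -
  from assms(2) obtain M :: "'a model" where M: "is_model M T" "infinite (univ M)"
    by (auto simp: has_infinite_model_def)
  then show ?thesis
    using complete_theory_mem_iff[OF assms(1) M(1) size_sentence_in_sentences]
      holds_in_size_sentence[of M n] at_least_infinite by (auto simp: is_model_def)
qed

lemma has_finite_model_size_bound:
  assumes "has_finite_model T"
  shows "\<exists>n. \<forall>m > n. size_sentence m \<notin> T"
proof -
  from assms obtain M :: "'a model" where M: "is_model M T" "finite (univ M)"
    by (auto simp: has_finite_model_def)
  then have "\<forall>m > card (univ M). size_sentence m \<notin> T"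
    using holds_in_size_sentence[of M] by (auto simp: is_model_def at_least_finite)
  then show ?thesis by blast
qed

lemma not_subset_finite_unary_theory:
  assumes "complete_theory L T" and "has_infinite_model T" and "T' \<in> finite_unary_theories"
  shows "\<not> T \<subseteq> T'"
  using size_sentence_in_theory[OF assms(1,2)] has_finite_model_size_bound[of T'] assms(3)
  by (auto simp: finite_unary_theories_def)

text \<open>Finitely many members have a common bound on the \<open>size_sentence\<close>s they
  contain, but \<open>T\<close> contains all of these.\<close>

lemma infinite_approximating:
  assumes "complete_theory L T" and "has_infinite_model T"
    and "\<T> \<subseteq> finite_unary_theories" and "approximable_by \<T> T"
  shows "infinite \<T>"
proof
  assume "finite \<T>"
  have "\<forall>T' \<in> \<T>. \<exists>n. \<forall>m > n. size_sentence m \<notin> T'"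
    using assms(3) has_finite_model_size_bound by (auto simp: finite_unary_theories_def)
  then obtain f where f: "\<And>T' m. T' \<in> \<T> \<Longrightarrow> m > f T' \<Longrightarrow> size_sentence m \<notin> T'"
    by metis
  from \<open>finite \<T>\<close> obtain n where "\<forall>T' \<in> \<T>. f T' < n"
    using finite_nat_set_iff_bounded[of "f ` \<T>"] by auto
  with f have "\<forall>T' \<in> \<T>. size_sentence n \<notin> T'" by blast
  then show False
    using size_sentence_in_theory[OF assms(1,2), of n] assms(4)
    by (auto simp: approximable_by_def)
qed

text \<open>Members are countable, having finite languages, so the union of an infinite family,
  which covers \<open>T\<close>, is no larger than the family.\<close>

lemma card_of_approximating:
  assumes "complete_theory L T" and "has_infinite_model T"
    and "\<T> \<subseteq> finite_unary_theories" and "approximable_by \<T> T"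
  shows "|T| \<le>o |\<T>|"
proof -
  have inf: "infinite \<T>" by (rule infinite_approximating[OF assms])
  have "|T'| \<le>o |\<T>|" if "T' \<in> \<T>" for T'
  proof -
    from that assms(3) obtain J where J: "finite J" "complete_theory (unary J) T'"
      by (auto simp: finite_unary_theories_def)
    then have "countable T'"
      using countable_sentences[OF countable_finite[OF J(1)]]
      by (auto simp: complete_theory_def intro: countable_subset)
    then show ?thesis
      using inf by (meson countable_ordLeq_nat infinite_iff_card_of_nat ordLeq_transitive)
  qed
  then have "|\<Union>T' \<in> \<T>. T'| \<le>o |\<T>|"
    by (intro card_of_UNION_ordLeq_infinite[OF inf] card_of_mono1 ballI) auto
  moreover have "T \<subseteq> (\<Union>T' \<in> \<T>. T')"
    using assms(4) by (auto simp: approximable_by_def)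
  ultimately show ?thesis
    by (meson card_of_mono1 ordLeq_transitive)
qed

lemma exactly_card_approximable_finite_unary_theories:
  assumes "complete_theory (unary I) T" and "has_infinite_model T"
  shows "exactly_card_approximable |T| finite_unary_theories T"
  unfolding exactly_card_approximable_def
proof (intro conjI allI impI)
  obtain f where f: "\<And>\<phi>. \<phi> \<in> T \<Longrightarrow> f \<phi> \<in> finite_unary_theories \<and> \<phi> \<in> f \<phi>"
    using exists_finite_unary_theory[OF assms(1)] by metis
  then have sub: "f ` T \<subseteq> finite_unary_theories" by blast
  then have "T \<notin> f ` T"
    using not_subset_finite_unary_theory[OF assms] by blast
  with f have "approximable_by (f ` T) T" by (auto simp: approximable_by_def)
  \<comment> \<open>An image is never larger than \<open>T\<close>, and an approximating family is
    never smaller.\<close>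
  moreover from this have "|f ` T| =o |T|"
    using card_of_approximating[OF assms sub] card_of_image by (simp add: ordIso_iff_ordLeq)
  ultimately show "card_approximable |T| finite_unary_theories T"
    using sub by (auto simp: card_approximable_def)
next
  fix \<mu> :: "'a form rel"
  assume \<mu>: "Card_order \<mu> \<and> \<mu> <o |T|"
  show "\<not> card_approximable \<mu> finite_unary_theories T"
  proof
    assume "card_approximable \<mu> finite_unary_theories T"
    then obtain \<T> where \<T>: "\<T> \<subseteq> finite_unary_theories" "|\<T>| =o \<mu>" "approximable_by \<T> T"
      by (auto simp: card_approximable_def)
    then have "|T| \<le>o |\<T>|" using card_of_approximating[OF assms] by blast
    then have "|T| \<le>o \<mu>" using \<T>(2) by (rule ordLeq_ordIso_trans)
    with \<mu> show False using not_ordLeq_ordLess by blast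
  qed
qed

lemma countably_approximable_finite_language:
  assumes "complete_theory (unary I) T" and "has_infinite_model T" and "finite I"
  shows "countably_approximable_by finite_unary_theories T"
proof -
  from exactly_card_approximable_finite_unary_theories[OF assms(1,2)]
  obtain \<T> where \<T>: "\<T> \<subseteq> finite_unary_theories" "|\<T>| =o |T|" "approximable_by \<T> T"
    by (auto simp: exactly_card_approximable_def card_approximable_def)
  \<comment> \<open>The family is infinite and equinumerous with \<open>T\<close>.\<close>
  then have "infinite T"
    using infinite_approximating[OF assms(1,2)] card_of_ordIso_finite by blast
  moreover have "countable T"
    using countable_sentences[OF countable_finite[OF assms(3)]] assms(1)
    by (auto simp: complete_theory_def intro: countable_subset)
  ultimately have "|T| =o |UNIV :: nat set|"
    by (simp add: ordIso_iff_ordLeq countable_ordLeq_nat infinite_iff_card_of_nat)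
  then have "|\<T>| =o natLeq"
    using \<T>(2) card_of_nat by (meson ordIso_transitive)
  with \<T> show ?thesis
    by (auto simp: countably_approximable_by_def card_approximable_def)
qed

section \<open>Infinite languages\<close>

text \<open>A sentence has finitely many symbols, so it misses some \<open>p n\<close> and survives
  in the reduct without it. The models of \<open>T\<close> may be finite or infinite.\<close>

lemma countably_approximable_infinite_language:
  fixes I :: "'p set"
  assumes T: "complete_theory (unary I) T" and "infinite I"
  shows "\<exists>\<T>. (\<forall>T' \<in> \<T>. \<exists>J. complete_theory (unary J) T') \<and>
             approximating_class \<T> T \<and> countably_approximable_by \<T> T"
proof -
  obtain p :: "nat \<Rightarrow> 'p" where p: "inj p" "range p \<subseteq> I"
    using infinite_countable_subset[OF assms(2)] by blast
  define R where "R n = T \<inter> sentences (unary (I - {p n}))" for n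
  have "unary (I - {p n}) \<subseteq> unary I" for n by (auto simp: unary_def)
  then have R: "complete_theory (unary (I - {p n})) (R n)" for n
    unfolding R_def by (rule complete_theory_reduct[OF T])
  \<comment> \<open>\<open>\<sigma> n\<close> is a member of \<open>T\<close> mentioning exactly
    \<open>p n\<close>. It lies in every reduct but \<open>R n\<close>, which makes the reducts
    distinct and none of them contain \<open>T\<close>.\<close>
  define \<sigma> where "\<sigma> n = (let \<phi> = Exists 0 (Rel (p n) [0]) in if \<phi> \<in> T then \<phi> else Neg \<phi>)" for n
  have "Exists 0 (Rel (p n) [0]) \<in> sentences (unary I)" for n
    using p(2) by (auto simp: sentences_def unary_def)
  then have "Exists 0 (Rel (p n) [0]) \<in> T \<or> Neg (Exists 0 (Rel (p n) [0])) \<in> T" for n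
    using T by (auto simp: complete_theory_def)
  then have \<sigma>: "\<sigma> n \<in> T" "\<sigma> n \<in> sentences (unary I)" "symbols (\<sigma> n) = {(p n, 1)}" for n
    using T by (auto simp: \<sigma>_def Let_def complete_theory_def)
  have mem: "\<sigma> m \<in> R n \<longleftrightarrow> m \<noteq> n" for m n
    using \<sigma>[of m] inj_eq[OF p(1), of m n] by (auto simp: R_def sentences_def unary_def)
  then have "inj R" by (metis injI)
  then have "|range R| =o |UNIV :: nat set|"
    by (meson card_of_ordIsoI inj_on_imp_bij_betw ordIso_symmetric)
  then have "|range R| =o natLeq" using card_of_nat by (rule ordIso_transitive)
  moreover have not_sub: "\<not> T \<subseteq> R n" for n using mem[of n n] \<sigma>(1)[of n] by blast
  moreover have "\<exists>T' \<in> range R. \<phi> \<in> T'" if "\<phi> \<in> T" for \<phi>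
  proof -
    have "finite (fst ` symbols \<phi>)" using finite_symbols by blast
    then have "\<not> range p \<subseteq> fst ` symbols \<phi>"
      using range_inj_infinite[OF p(1)] finite_subset by blast
    then obtain n where "p n \<notin> fst ` symbols \<phi>" by blast
    moreover have "\<phi> \<in> sentences (unary I)"
      using that T by (auto simp: complete_theory_def)
    moreover from this have "symbols \<phi> \<subseteq> unary I" by (simp add: sentences_def)
    ultimately have "symbols \<phi> \<subseteq> unary (I - {p n})"
      by (auto simp: unary_def subset_eq image_iff)
    with that \<open>\<phi> \<in> sentences (unary I)\<close> have "\<phi> \<in> R n"
      by (simp add: R_def sentences_def)
    then show ?thesis by blast
  qed
  ultimately have "countably_approximable_by (range R) T"
    unfolding countably_approximable_by_def card_approximable_def approximable_by_def by blast
  moreover have "approximating_class (range R) T"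
    unfolding approximating_class_def using R not_sub by blast
  ultimately show ?thesis using R by blast
qed

section \<open>Finite models of finite languages\<close>

lemma exists_characteristic_sentence:
  fixes M :: "('p, 'a) struct"
  assumes "finite I" and "finite (univ M)" and "univ M \<noteq> {}"
  shows "\<exists>\<phi> \<in> sentences (unary I). holds_in M \<phi> \<and> symbols \<phi> = unary I \<and>
     (\<forall>N :: ('p, 'b) struct. univ N \<noteq> {} \<longrightarrow> holds_in N \<phi> \<longrightarrow> (\<forall>k. similar k I M N))"
proof -
  obtain ps where ps: "set ps = I" using finite_list[OF assms(1)] by blast
  \<comment> \<open>One more than the size of \<open>M\<close>, so that no colour class of
    \<open>M\<close> reaches threshold \<open>n\<close>.\<close>
  define n where "n = Suc (card (univ M))"
  have "finite (Pow I \<times> {..n})" using assms(1) by simp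
  from finite_list[OF this] obtain ls where ls: "set ls = Pow I \<times> {..n}" ..
  define lit where "lit = (\<lambda>(S, m). if at_least m (color_class I M S)
    then color_sentence ps S m else Neg (color_sentence ps S m))"
  define \<phi> where "\<phi> = conj_list (map lit ls)"
  have sym: "symbols (lit (S, m)) = (if m = 0 then {} else unary I)" for S m
    by (auto simp: lit_def symbols_color_sentence ps)
  have "lit (S, m) \<in> sentences (unary I)" for S m
    using color_sentence_in_sentences[of ps S m] by (auto simp: lit_def sentences_def ps)
  then have sent: "\<phi> \<in> sentences (unary I)"
    by (fastforce simp: \<phi>_def sentences_def)
  \<comment> \<open>A single positive threshold suffices to make all symbols occur.\<close>
  have "({}, 1) \<in> set ls" by (simp add: ls n_def)
  then have "symbols (lit ({}, 1)) \<subseteq> symbols \<phi>" by (force simp: \<phi>_def)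
  then have "symbols \<phi> = unary I" using sent by (simp add: sym sentences_def)
  \<comment> \<open>The universe type is kept general so that this applies to \<open>M\<close> as
    well as to \<open>N\<close>.\<close>
  have sat: "sat N e \<phi> \<longleftrightarrow> (\<forall>S \<subseteq> I. \<forall>m \<le> n.
      at_least m (color_class I N S) \<longleftrightarrow> at_least m (color_class I M S))"
    for N :: "('p, 'c) struct" and e
    using sat_color_sentence[of _ ps N e] by (auto simp: \<phi>_def lit_def ls ps)
  have "similar k I M N" if "univ N \<noteq> {}" "holds_in N \<phi>" for k and N :: "('p, 'b) struct"
    unfolding similar_def
  proof (intro allI impI)
    fix m S
    have small: "at_least m (color_class I M S) \<longleftrightarrow> at_least m (color_class I N S)"
      if "m \<le> n" for m
    proof (cases "S \<subseteq> I")
      case True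
      with that show ?thesis
        using sat[of N "\<lambda>_. undefined"] holds_in_iff_sat[OF sent \<open>univ N \<noteq> {}\<close>]
          \<open>holds_in N \<phi>\<close> by blast
    next
      case False
      then have "color_class I M S = {}" "color_class I N S = {}"
        by (auto simp: color_class_def color_def)
      then show ?thesis by (simp add: at_least_finite)
    qed
    \<comment> \<open>Agreement at \<open>n\<close> makes the classes of \<open>N\<close> miss that
      threshold too, so both sides fail at all larger ones.\<close>
    have "\<not> at_least n (univ M)"
      using assms(2) by (simp add: at_least_finite n_def)
    then have "\<not> at_least n (color_class I M S)"
      using at_least_subset[of n "color_class I M S" "univ M"] by (auto simp: color_class_def)
    with small show "at_least m (color_class I M S) \<longleftrightarrow> at_least m (color_class I N S)"
      by (metis at_least_antimono linear)
  qed
  moreover have "holds_in M \<phi>"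
    using sat[of M] by (simp add: holds_in_def)
  ultimately show ?thesis using sent \<open>symbols \<phi> = unary I\<close> by blast
qed

text \<open>A theory containing the characteristic sentence has all of \<open>I\<close> in its
  language and a model similar to \<open>M\<close> at every threshold, so it contains
  \<open>T\<close>.\<close>

lemma not_approximable_finite_language:
  fixes I :: "'p set"
  assumes T: "complete_theory (unary I) T" and "has_finite_model T" and "finite I"
  shows "\<not> approximable T"
proof
  assume "approximable T"
  then obtain \<T> where \<T>: "approximating_class \<T> T" "approximable_by \<T> T"
    by (auto simp: approximable_def)
  obtain M :: "'p model" where M: "is_model M T" "finite (univ M)"
    using assms(2) by (auto simp: has_finite_model_def)
  then have "univ M \<noteq> {}" by (simp add: is_model_def)
  from exists_characteristic_sentence[OF assms(3) M(2) this, where ?'b = "'p + nat"]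
  obtain \<phi> where \<phi>: "\<phi> \<in> sentences (unary I)" "holds_in M \<phi>" "symbols \<phi> = unary I"
    "\<And>(N :: 'p model) k. univ N \<noteq> {} \<Longrightarrow> holds_in N \<phi> \<Longrightarrow> similar k I M N"
    by auto
  then have "\<phi> \<in> T" using complete_theory_mem_iff[OF T M(1)] by blast
  then obtain T' L where T': "T' \<in> \<T>" "\<phi> \<in> T'" "complete_theory L T'"
    using \<T> unfolding approximable_by_def approximating_class_def by meson
  then obtain N :: "'p model" where N: "is_model N T'"
    by (auto simp: complete_theory_def)
  then have "univ N \<noteq> {}" "holds_in N \<phi>" using T' by (auto simp: is_model_def)
  have "unary I \<subseteq> L"
    using T' \<phi>(3) by (auto simp: complete_theory_def sentences_def)
  have "T \<subseteq> T'"
  proof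
    fix \<psi> assume "\<psi> \<in> T"
    then have \<psi>: "\<psi> \<in> sentences (unary I)" using T by (auto simp: complete_theory_def)
    have "holds_in N \<psi>"
      using holds_in_similar[OF \<psi> \<phi>(4)[OF \<open>univ N \<noteq> {}\<close> \<open>holds_in N \<phi>\<close>]]
        \<open>univ M \<noteq> {}\<close> \<open>univ N \<noteq> {}\<close> M(1) \<open>\<psi> \<in> T\<close> by (auto simp: is_model_def)
    then show "\<psi> \<in> T'"
      using complete_theory_mem_iff[OF T'(3) N] \<psi> sentences_mono[OF \<open>unary I \<subseteq> L\<close>] by blast
  qed
  \<comment> \<open>\<open>approximable_by\<close> rules out equality with \<open>T\<close>, and
    \<open>approximating_class\<close> rules out proper inclusion.\<close>
  then show False
    using \<T> T'(1) by (auto simp: approximable_by_def approximating_class_def)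
qed

lemma countably_approximable_imp_approximable:
  assumes "countably_approximable T"
  shows "approximable T"
proof -
  from assms obtain \<T> \<T>' where "approximating_class \<T> T" "\<T>' \<subseteq> \<T>" "approximable_by \<T>' T"
    by (auto simp: countably_approximable_def countably_approximable_by_def card_approximable_def)
  moreover from this have "approximating_class \<T>' T"
    unfolding approximating_class_def by (meson subsetD)
  ultimately show ?thesis by (auto simp: approximable_def)
qed

theorem theorem4p2:
  shows "(\<forall>(I :: 'p set) T0.
            complete_theory (unary I) T0 \<and> has_infinite_model T0 \<longrightarrow>
            exactly_card_approximable |T0| finite_unary_theories T0)
       \<and> (\<forall>(I :: 'p set) T0.
            complete_theory (unary I) T0 \<and> has_infinite_model T0 \<longrightarrow>
            (\<exists>\<T>. (\<forall>T' \<in> \<T>. \<exists>J. complete_theory (unary J) T') \<and>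
                 approximating_class \<T> T0 \<and> countably_approximable_by \<T> T0))
       \<and> (\<forall>(I :: 'p set) T1.
            complete_theory (unary I) T1 \<and> has_finite_model T1 \<longrightarrow>
            (approximable T1 \<longleftrightarrow> infinite I) \<and>
            (countably_approximable T1 \<longleftrightarrow> infinite I))"
proof (intro conjI allI impI; elim conjE)
  fix I :: "'p set" and T
  assume T: "complete_theory (unary I) T" "has_infinite_model T"
  show "exactly_card_approximable |T| finite_unary_theories T"
    by (rule exactly_card_approximable_finite_unary_theories[OF T])
  show "\<exists>\<T>. (\<forall>T' \<in> \<T>. \<exists>J. complete_theory (unary J) T') \<and>
             approximating_class \<T> T \<and> countably_approximable_by \<T> T"
  \<comment> \<open>Omitting symbols gives infinitely many reducts only in an infinite language; in
    a finite one the theories with finite models are used.\<close>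
  proof (cases "finite I")
    case True
    then have "countably_approximable_by finite_unary_theories T"
      by (rule countably_approximable_finite_language[OF T])
    moreover have "\<forall>T' \<in> finite_unary_theories. \<exists>J. complete_theory (unary J) T'"
      by (auto simp: finite_unary_theories_def)
    moreover from this have "approximating_class finite_unary_theories T"
      unfolding approximating_class_def using not_subset_finite_unary_theory[OF T] by blast
    ultimately show ?thesis by blast
  next
    case False
    then show ?thesis by (rule countably_approximable_infinite_language[OF T(1)])
  qed
next
  fix I :: "'p set" and T
  assume T: "complete_theory (unary I) T" "has_finite_model T"
  have "\<not> approximable T" if "finite I"
    using not_approximable_finite_language[OF T that] .
  moreover have "countably_approximable T" if "infinite I"
    using countably_approximable_infinite_language[OF T(1) that]
    by (auto simp: countably_approximable_def)
  ultimately show "approximable T \<longleftrightarrow> infinite I" "countably_approximable T \<longleftrightarrow> infinite I"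
    using countably_approximable_imp_approximable by blast+
qed

end
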